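(* Let $N\in\mathbb{N}$, let $X$ be a nonempty connected closed subset of a complete metric space, with metric $d_X$, and let $X_1,\dots,X_N$ be nonempty connected subsets of $X$. Let $Y$ be an $F$-space with homogeneous metric $d_Y$. Let $u_i:X_i\to X$, $i=1,\dots,N$, be Lipschitz mappings, each a bijection onto its image, such that the sets $u_1(X_1),\dots,u_N(X_N)$ are pairwise disjoint with union $X$; let $a_i$ be the Lipschitz constant of $u_i$ and let $a:=\max\{a_i : i=1,\dots,N\}$ be the largest of these Lipschitz constants. Let $\lambda_i\in B(X_i,Y)$ and $S_i\in B(X_i,\mathbb{R})$ with $\max_i\|S_i\|_{\infty,X_i}<1$, put $v_i(x,y):=\lambda_i(x)+S_i(x)\,y$ for $(x,y)\in X_i\times Y$, and assume there is a constant $L>0$ such that $d_Y(v_i(x_1,y),v_i(x_2,y))\le L\,d_X(x_1,x_2)$ for all $x_1,x_2\in X_i$, all $y\in Y$ and all $i=1,\dots,N$. Let $\Phi$ be the operator on $B(X,Y)$ given by $$\Phi f=\sum_{i=1}^N (\lambda_i\circ u_i^{-1})\,\chi_{u_i(X_i)}+\sum_{i=1}^N (S_i\circ u_i^{-1})\cdot(f|_{X_i}\circ u_i^{-1})\,\chi_{u_i(X_i)},$$ and let $\mathfrak{f}\in B(X,Y)$ be its unique fixed point. Define $w_i:X_i\times Y\to X\times Y$ by $w_i(x,y):=(u_i(x),v_i(x,y))$, let $\theta:=\frac{1-a}{2L}$, and let $d_\theta:=d_X+\theta\, d_Y$, i.e. $d_\theta((x_1,y_1),(x_2,y_2))=d_X(x_1,x_2)+\theta\,d_Y(y_1,y_2)$,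 which is a metric for $X\times Y$ compatible with the product topology on $X\times Y$. Then the family $\mathcal{W}_{\mathrm{loc}}:=\{X\times Y;(X_i\times Y,w_i) : i=1,\dots,N\}$ is a contractive local iterated function system in the metric $d_\theta$, and the graph $G(\mathfrak{f})=\{(x,\mathfrak{f}(x)) : x\in X\}$ of the local fractal function $\mathfrak{f}$ is an attractor of $\mathcal{W}_{\mathrm{loc}}$. Moreover, $G(\Phi\mathfrak{f})=\mathcal{W}_{\mathrm{loc}}(G(\mathfrak{f}))$, where $\mathcal{W}_{\mathrm{loc}}$ on the right denotes the set-valued operator associated with the local iterated function system $\mathcal{W}_{\mathrm{loc}}$.
   Context: An $F$-space is a (real) topological vector space whose topology is induced by a complete translation-invariant metric $d_Y$; the metric is homogeneous if $d_Y(\alpha y_1,\alpha y_2)=|\alpha|d_Y(y_1,y_2)$ for all real $\alpha$ and all $y_1,y_2\in Y$. $B(X,Y)$ is the set of bounded maps $f:X\to Y$ (i.e. there is $M>0$ with $d_Y(f(x_1),f(x_2))<M$ for all $x_1,x_2\in X$) with metric $\sup_{x\in X} d_Y(f(x),g(x))$; similarly $B(X_i,Y)$, $B(X_i,\mathbb{R})$. $\|\cdot\|_{\infty,X_i}$ is the supremum norm on $X_i$ and $\chi_M$ the characteristic function of $M$. Under the given hypotheses $\Phi$ is a contraction on the complete metric space $B(X,Y)$, so $\mathfrak f$ exists and is unique; it is called a local fractal function. A local iterated function system (local IFS) on a metric space $Z$ is a family $\{Z;(Z_i,f_i): i=1,\dots,N\}$ of nonempty subsets $Z_i\subset Z$ and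 continuous maps $f_i:Z_i\to Z$. It is contractive if there is a metric $d^*$ equivalent to the metric of $Z$ with respect to which each $f_i$ is a contraction on $Z_i$ (contractive in the metric $d^*$). Its associated set-valued operator (denoted by the same symbol as the local IFS) is $S\mapsto\bigcup_{i=1}^N f_i(S\cap Z_i)$ for $S\subset Z$, and a subset $A\subset Z$ is called a (local) attractor if $A=\bigcup_{i=1}^N f_i(A\cap Z_i)$.
   Formalization: The formal theorem adds the hypothesis a < 1 on the largest Lipschitz constant; for a ≥ 1 the claim fails (e.g. N = 1, u_1 = id gives θ = 0, so d_θ is not a metric). *)

theory Defs
  imports "HOL-Analysis.Analysis"
begin

text \<open>The whole type is the space \<open>Y\<close>, and \<open>d\<^sub>Y\<close> is \<^const>\<open>dist\<close>. The class
  \<^class>\<open>complete_space\<close> already says that \<^const>\<open>dist\<close> induces the topology and is complete.\<close>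

class F_space = real_vector + complete_space + topological_monoid_add +
  assumes tendsto_scaleR_pair: "LIM p (nhds c \<times>\<^sub>F nhds y). fst p *\<^sub>R snd p :> nhds (c *\<^sub>R y)"
    and dist_translation_invariant: "dist (x + z) (y + z) = dist x y"

definition homogeneous_metric :: "('a::real_vector \<Rightarrow> 'a \<Rightarrow> real) \<Rightarrow> bool" where
  "homogeneous_metric d \<longleftrightarrow> (\<forall>\<alpha> y\<^sub>1 y\<^sub>2. d (\<alpha> *\<^sub>R y\<^sub>1) (\<alpha> *\<^sub>R y\<^sub>2) = \<bar>\<alpha>\<bar> * d y\<^sub>1 y\<^sub>2)"

text \<open>The set \<open>B(X,Y)\<close>. A map defined only on \<open>X\<close> is represented by its extension that is
  \<^const>\<open>undefined\<close> outside \<open>X\<close>, so that equality of such maps is equality on \<open>X\<close>.\<close>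

definition bounded_maps :: "'a set \<Rightarrow> ('a \<Rightarrow> 'b::metric_space) set" where
  "bounded_maps X = mspace (funspace X euclidean_metric)"

lemma bounded_maps_iff:
  "f \<in> bounded_maps X \<longleftrightarrow>
    f \<in> extensional X \<and> (\<exists>M>0. \<forall>x\<^sub>1\<in>X. \<forall>x\<^sub>2\<in>X. dist (f x\<^sub>1) (f x\<^sub>2) < M)"
proof -
  have "bounded (f ` X) \<longleftrightarrow> (\<exists>M>0. \<forall>x\<^sub>1\<in>X. \<forall>x\<^sub>2\<in>X. dist (f x\<^sub>1) (f x\<^sub>2) < M)"
    unfolding bounded_two_points
  proof
    assume "\<exists>e. \<forall>x\<in>f ` X. \<forall>y\<in>f ` X. dist x y \<le> e"
    then obtain e where "\<forall>x\<in>f ` X. \<forall>y\<in>f ` X. dist x y \<le> e" ..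
    then have "\<forall>x\<^sub>1\<in>X. \<forall>x\<^sub>2\<in>X. dist (f x\<^sub>1) (f x\<^sub>2) < \<bar>e\<bar> + 1"
      by fastforce
    then show "\<exists>M>0. \<forall>x\<^sub>1\<in>X. \<forall>x\<^sub>2\<in>X. dist (f x\<^sub>1) (f x\<^sub>2) < M"
      by (intro exI[of _ "\<bar>e\<bar> + 1"]) simp
  qed (auto intro: less_imp_le)
  then show ?thesis
    by (auto simp: bounded_maps_def Met_TC.fspace_def)
qed

definition sup_norm_on :: "'a set \<Rightarrow> ('a \<Rightarrow> real) \<Rightarrow> real" where
  "sup_norm_on X s = (SUP x\<in>X. \<bar>s x\<bar>)"

definition lipschitz_constant :: "'a::metric_space set \<Rightarrow> ('a \<Rightarrow> 'b::metric_space) \<Rightarrow> real" where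
  "lipschitz_constant X f = Inf {C. C-lipschitz_on X f}"

definition graph_on :: "'a set \<Rightarrow> ('a \<Rightarrow> 'b) \<Rightarrow> ('a \<times> 'b) set" where
  "graph_on X f = {(x, f x) |x. x \<in> X}"

definition fractal_operator ::
  "nat \<Rightarrow> 'a set \<Rightarrow> (nat \<Rightarrow> 'a set) \<Rightarrow> (nat \<Rightarrow> 'a \<Rightarrow> 'a) \<Rightarrow> (nat \<Rightarrow> 'a \<Rightarrow> 'b::real_vector) \<Rightarrow>
    (nat \<Rightarrow> 'a \<Rightarrow> real) \<Rightarrow> ('a \<Rightarrow> 'b) \<Rightarrow> 'a \<Rightarrow> 'b" where
  "fractal_operator N X Xs u lam S f =
    (\<lambda>x\<in>X.
      (\<Sum>i=1..N. indicat_real (u i ` Xs i) x *\<^sub>R (lam i \<circ> inv_into (Xs i) (u i)) x) +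
      (\<Sum>i=1..N. indicat_real (u i ` Xs i) x *\<^sub>R
        ((S i \<circ> inv_into (Xs i) (u i)) x *\<^sub>R (restrict f (Xs i) \<circ> inv_into (Xs i) (u i)) x)))"

definition local_IFS ::
  "'z::metric_space set \<Rightarrow> nat \<Rightarrow> (nat \<Rightarrow> 'z set) \<Rightarrow> (nat \<Rightarrow> 'z \<Rightarrow> 'z) \<Rightarrow> bool" where
  "local_IFS Z N Zs f \<longleftrightarrow>
    (\<forall>i\<in>{1..N}. Zs i \<noteq> {} \<and> Zs i \<subseteq> Z \<and> f i ` Zs i \<subseteq> Z \<and> continuous_on (Zs i) (f i))"

text \<open>Equivalent metrics are those inducing the same topology on \<open>Z\<close>.\<close>

definition contractive_local_IFS_in ::
  "('z::metric_space \<Rightarrow> 'z \<Rightarrow> real) \<Rightarrow> 'z set \<Rightarrow> nat \<Rightarrow> (nat \<Rightarrow> 'z set) \<Rightarrow> (nat \<Rightarrow> 'z \<Rightarrow> 'z) \<Rightarrow> bool"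
where
  "contractive_local_IFS_in d Z N Zs f \<longleftrightarrow>
    local_IFS Z N Zs f \<and>
    Metric_space Z d \<and> Metric_space.mtopology Z d = top_of_set Z \<and>
    (\<forall>i\<in>{1..N}. \<exists>c. 0 \<le> c \<and> c < 1 \<and> (\<forall>p\<in>Zs i. \<forall>q\<in>Zs i. d (f i p) (f i q) \<le> c * d p q))"

definition local_IFS_operator ::
  "nat \<Rightarrow> (nat \<Rightarrow> 'z set) \<Rightarrow> (nat \<Rightarrow> 'z \<Rightarrow> 'z) \<Rightarrow> 'z set \<Rightarrow> 'z set" where
  "local_IFS_operator N Zs f A = (\<Union>i\<in>{1..N}. f i ` (A \<inter> Zs i))"

definition local_attractor ::
  "'z set \<Rightarrow> nat \<Rightarrow> (nat \<Rightarrow> 'z set) \<Rightarrow> (nat \<Rightarrow> 'z \<Rightarrow> 'z) \<Rightarrow> 'z set \<Rightarrow> bool" where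
  "local_attractor Z N Zs f A \<longleftrightarrow> A \<subseteq> Z \<and> A = local_IFS_operator N Zs f A"

end

theory Submission
  imports Defs
begin

text \<open>The maps \<open>w i\<close> act on graphs exactly as \<open>\<Phi>\<close> acts on functions. Since the sets \<open>u i ` Xs i\<close>
  partition \<open>X\<close>, at a point \<open>u i x\<close> with \<open>x \<in> Xs i\<close> only the \<open>i\<close>-th summands of \<open>\<Phi> f\<close> survive, and
  \<open>\<Phi> f (u i x) = lam i x + S i x *\<^sub>R f x = v i (x, f x)\<close> (\<open>fractal_operator_eq\<close>). So \<open>w i\<close> carries the
  point of the graph of \<open>f\<close> over \<open>x\<close> to the point of the graph of \<open>\<Phi> f\<close> over \<open>u i x\<close>, and as these
  base points exhaust \<open>X\<close>, the local IFS operator maps the graph of \<open>f\<close> onto the graph of \<open>\<Phi> f\<close>,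
  for every function \<open>f\<close> (\<open>graph_fractal_operator\<close>). The graph of a fixed point of \<open>\<Phi>\<close> is therefore an
  attractor.

  A fixed point exists and is unique by Banach's theorem, applied in the complete space \<open>B(X, Y)\<close>:
  translation invariance cancels \<open>lam i\<close>, and homogeneity of the metric turns the factor \<open>S i\<close> into
  a contraction factor \<open>max\<^sub>i \<parallel>S i\<parallel> < 1\<close> (\<open>fractal_operator_unique_fixed_point\<close>).

  For contractivity, note that \<open>w i\<close> shrinks the base by \<open>a\<close> and each fibre by \<open>\<parallel>S i\<parallel>\<close>; the only
  obstruction is the shear, by which a displacement \<open>\<delta>\<close> in the base moves the fibre coordinate by up
  to \<open>L \<delta>\<close>. Weighting the fibre metric by a small \<open>\<theta>\<close> damps it: the base factor becomes
  \<open>a + \<theta> L\<close> while the fibre factor is unchanged (\<open>skew_product_contraction\<close>), and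
  \<open>\<theta> = (1 - a) / (2 L)\<close> makes \<open>a + \<theta> L\<close> the midpoint of \<open>a\<close> and \<open>1\<close>. The weight changes the metric
  only up to constant factors, so the topology remains the product topology
  (\<open>mtopology_weighted_sum_metric\<close>), and each \<open>w i\<close> is continuous because it is a contraction.\<close>

section \<open>Lipschitz constants, supremum norms and bounded maps\<close>

text \<open>For fixed points \<open>x \<noteq> y\<close>, the quotient \<open>dist (f x) (f y) / dist x y\<close> is a lower bound of all
  Lipschitz bounds, hence at most their infimum; so the infimum is attained.\<close>

lemma lipschitz_on_lipschitz_constant:
  assumes "\<exists>C. C-lipschitz_on A f"
  shows "(lipschitz_constant A f)-lipschitz_on A f"
proof (rule lipschitz_onI)
  have ne: "{C. C-lipschitz_on A f} \<noteq> {}"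
    using assms by blast
  show "0 \<le> lipschitz_constant A f"
    unfolding lipschitz_constant_def by (rule cInf_greatest[OF ne]) (auto dest: lipschitz_on_nonneg)
  fix x y assume xy: "x \<in> A" "y \<in> A"
  show "dist (f x) (f y) \<le> lipschitz_constant A f * dist x y"
  proof (cases "x = y")
    case False
    have "dist (f x) (f y) / dist x y \<le> lipschitz_constant A f"
      unfolding lipschitz_constant_def
    proof (rule cInf_greatest[OF ne])
      fix C assume "C \<in> {C. C-lipschitz_on A f}"
      then show "dist (f x) (f y) / dist x y \<le> C"
        using lipschitz_onD[of C A f x y] xy False by (simp add: field_simps)
    qed
    then show ?thesis
      using False by (simp add: field_simps)
  qed simp
qed

lemma bounded_maps_iff_bounded_image:
  "f \<in> bounded_maps A \<longleftrightarrow> f \<in> extensional A \<and> bounded (f ` A)"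
  by (auto simp: bounded_maps_def Met_TC.fspace_def)

lemma abs_le_sup_norm_on:
  assumes "s \<in> bounded_maps A" "x \<in> A"
  shows "\<bar>s x\<bar> \<le> sup_norm_on A s"
proof -
  have "bounded (s ` A)"
    using assms by (simp add: bounded_maps_iff_bounded_image)
  then have "bdd_above ((\<lambda>x. \<bar>s x\<bar>) ` A)"
    by (auto simp: bounded_iff bdd_above_def)
  then show ?thesis
    unfolding sup_norm_on_def using \<open>x \<in> A\<close> by (rule cSUP_upper2) simp
qed

lemma dist_add_left_F_space: "dist (z + x) (z + y) = dist x (y :: 'a::F_space)"
  using dist_translation_invariant[of x z y] by (simp add: add.commute)

text \<open>In an F-space whose metric is homogeneous, the distance to \<open>0\<close> behaves like a norm under
  scaling and addition; this is why \<open>\<Phi>\<close> preserves boundedness.\<close>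

lemma bounded_affine_image_F_space:
  fixes l f :: "'a \<Rightarrow> 'b::F_space"
  assumes hom: "homogeneous_metric (dist :: 'b \<Rightarrow> 'b \<Rightarrow> real)"
    and l: "bounded (l ` A)" and f: "bounded (f ` A)"
    and s: "\<And>x. x \<in> A \<Longrightarrow> \<bar>s x\<bar> \<le> c"
  shows "bounded ((\<lambda>x. l x + s x *\<^sub>R f x) ` A)"
proof -
  obtain B where B: "\<And>x. x \<in> A \<Longrightarrow> dist 0 (l x) \<le> B"
    using l by (auto simp: bounded_any_center[where a = 0])
  obtain D where D: "\<And>x. x \<in> A \<Longrightarrow> dist 0 (f x) \<le> D"
    using f by (auto simp: bounded_any_center[where a = 0])
  have "dist 0 (l x + s x *\<^sub>R f x) \<le> B + c * D" if x: "x \<in> A" for x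
  proof -
    have "dist 0 (l x + s x *\<^sub>R f x) \<le> dist 0 (l x) + dist (l x + 0) (l x + s x *\<^sub>R f x)"
      using dist_triangle[of 0 "l x + s x *\<^sub>R f x" "l x"] by simp
    also have "dist (l x + 0) (l x + s x *\<^sub>R f x) = dist (s x *\<^sub>R 0) (s x *\<^sub>R f x)"
      by (simp add: dist_add_left_F_space del: add_0_right)
    also have "\<dots> = \<bar>s x\<bar> * dist 0 (f x)"
      using hom unfolding homogeneous_metric_def by blast
    also have "\<dots> \<le> c * D"
      using s[OF x] D[OF x] by (intro mult_mono) auto
    finally show ?thesis
      using B[OF x] by simp
  qed
  then show ?thesis
    by (auto simp: bounded_any_center[where a = 0])
qed

lemma mcomplete_complete_space: "Metric_space.mcomplete (UNIV :: 'a::complete_space set) dist"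
  unfolding Met_TC.mcomplete_def Met_TC.MCauchy_def limitin_iff_tendsto
  by (metis Cauchy_def complete_UNIV complete_def UNIV_I)

lemma mcomplete_bounded_maps:
  "Metric_space.mcomplete (bounded_maps A) (mdist (funspace A (euclidean_metric :: 'b::complete_space metric)))"
  using Met_TC.mcomplete_funspace[OF mcomplete_complete_space, of A]
  by (simp add: bounded_maps_def mcomplete_of_def Met_TC.Self_def flip: euclidean_metric_def)

section \<open>The weighted sum metric\<close>

text \<open>Balls of the two metrics can be nested in each other by rescaling the radius.\<close>

lemma mtopology_eq_top_of_set:
  fixes Z :: "'z::metric_space set"
  assumes d: "Metric_space Z d" and k: "k > 0" and K: "K > 0"
    and lower: "\<And>p q. p \<in> Z \<Longrightarrow> q \<in> Z \<Longrightarrow> k * dist p q \<le> d p q"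
    and upper: "\<And>p q. p \<in> Z \<Longrightarrow> q \<in> Z \<Longrightarrow> d p q \<le> K * dist p q"
  shows "Metric_space.mtopology Z d = top_of_set Z"
proof -
  interpret Metric_space Z d by (fact d)
  have "(\<exists>r>0. mball x r \<subseteq> U) \<longleftrightarrow> (\<exists>e>0. \<forall>y\<in>Z. dist y x < e \<longrightarrow> y \<in> U)"
    if x: "x \<in> U" and U: "U \<subseteq> Z" for x U
  proof
    assume "\<exists>r>0. mball x r \<subseteq> U"
    then obtain r where r: "r > 0" "mball x r \<subseteq> U" by blast
    have "y \<in> U" if y: "y \<in> Z" "dist y x < r / K" for y
    proof -
      have "K * dist x y < r"
        using y K by (simp add: dist_commute field_simps)
      then have "d x y < r"
        using upper[of x y] x U y by auto
      then have "y \<in> mball x r"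
        using x U y by auto
      then show ?thesis
        using r by blast
    qed
    then show "\<exists>e>0. \<forall>y\<in>Z. dist y x < e \<longrightarrow> y \<in> U"
      using r K by (intro exI[of _ "r / K"]) auto
  next
    assume "\<exists>e>0. \<forall>y\<in>Z. dist y x < e \<longrightarrow> y \<in> U"
    then obtain e where e: "e > 0" "\<And>y. y \<in> Z \<Longrightarrow> dist y x < e \<Longrightarrow> y \<in> U" by blast
    have "y \<in> U" if y: "y \<in> mball x (k * e)" for y
    proof -
      have "k * dist x y < k * e"
        using lower[of x y] y by auto
      then have "dist y x < e"
        using k by (simp add: dist_commute)
      then show ?thesis
        using e y by auto
    qed
    then show "\<exists>r>0. mball x r \<subseteq> U"
      using e k by (intro exI[of _ "k * e"]) auto
  qed
  then show ?thesis
    unfolding topology_eq openin_mtopology openin_euclidean_subtopology_iff by blast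
qed

context
  fixes d :: "'a::metric_space \<times> 'b::metric_space \<Rightarrow> 'a \<times> 'b \<Rightarrow> real" and \<theta> :: real
  assumes d: "\<And>x\<^sub>1 y\<^sub>1 x\<^sub>2 y\<^sub>2. d (x\<^sub>1, y\<^sub>1) (x\<^sub>2, y\<^sub>2) = dist x\<^sub>1 x\<^sub>2 + \<theta> * dist y\<^sub>1 y\<^sub>2"
    and \<theta>: "\<theta> > 0"
begin

lemma weighted_sum_metric_le: "d p q \<le> (1 + \<theta>) * dist p q"
proof -
  have "d p q = dist (fst p) (fst q) + \<theta> * dist (snd p) (snd q)"
    by (cases p; cases q) (simp add: d)
  also have "\<dots> \<le> dist p q + \<theta> * dist p q"
    using \<theta> by (intro add_mono mult_left_mono dist_fst_le dist_snd_le) auto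
  finally show ?thesis
    by (simp add: algebra_simps)
qed

lemma weighted_sum_metric_ge: "min 1 \<theta> * dist p q \<le> d p q"
proof -
  have "dist p q \<le> dist (fst p) (fst q) + dist (snd p) (snd q)"
    unfolding dist_prod_def by (rule sqrt_sum_squares_le_sum) auto
  then have "min 1 \<theta> * dist p q \<le> min 1 \<theta> * (dist (fst p) (fst q) + dist (snd p) (snd q))"
    using \<theta> by (intro mult_left_mono) auto
  also have "\<dots> \<le> 1 * dist (fst p) (fst q) + \<theta> * dist (snd p) (snd q)"
    unfolding distrib_left by (intro add_mono mult_right_mono) auto
  also have "\<dots> = d p q"
    by (cases p; cases q) (simp add: d)
  finally show ?thesis .
qed

lemma Metric_space_weighted_sum_metric: "Metric_space Z d"
proof
  fix p q r
  show "0 \<le> d p q"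
    using \<theta> by (cases p; cases q) (simp add: d)
  show "d p q = d q p"
    by (cases p; cases q) (simp add: d dist_commute)
  show "d p q = 0 \<longleftrightarrow> p = q"
    using \<theta> by (cases p; cases q) (simp add: d add_nonneg_eq_0_iff)
  show "d p r \<le> d p q + d q r"
  proof (cases p; cases q; cases r)
    fix x y x' y' x'' y''
    assume "p = (x, y)" "q = (x', y')" "r = (x'', y'')"
    moreover have "dist x x'' \<le> dist x x' + dist x' x''"
      by (rule dist_triangle)
    moreover have "\<theta> * dist y y'' \<le> \<theta> * (dist y y' + dist y' y'')"
      using \<theta> by (intro mult_left_mono dist_triangle) auto
    ultimately show ?thesis
      by (simp add: d algebra_simps)
  qed
qed

lemma mtopology_weighted_sum_metric: "Metric_space.mtopology Z d = top_of_set Z"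
  using \<theta> by (intro mtopology_eq_top_of_set[where k = "min 1 \<theta>" and K = "1 + \<theta>"]
      Metric_space_weighted_sum_metric weighted_sum_metric_ge weighted_sum_metric_le) auto

text \<open>The comparison with the product metric turns the bound for \<open>d\<close> into a Lipschitz bound for
  \<^const>\<open>dist\<close>, with a constant that may exceed \<open>1\<close>.\<close>

lemma contraction_imp_continuous_on_weighted_sum_metric:
  assumes c: "0 \<le> c"
    and con: "\<And>p q. p \<in> Z \<Longrightarrow> q \<in> Z \<Longrightarrow> d (g p) (g q) \<le> c * d p q"
  shows "continuous_on Z g"
proof -
  let ?C = "c * (1 + \<theta>) / min 1 \<theta>"
  have "?C-lipschitz_on Z g"
  proof (rule lipschitz_onI)
    fix p q assume pq: "p \<in> Z" "q \<in> Z"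
    have "min 1 \<theta> * dist (g p) (g q) \<le> c * d p q"
      using weighted_sum_metric_ge[of "g p" "g q"] con[OF pq] by linarith
    also have "\<dots> \<le> c * ((1 + \<theta>) * dist p q)"
      using c by (intro mult_left_mono weighted_sum_metric_le)
    finally show "dist (g p) (g q) \<le> ?C * dist p q"
      using \<theta> by (simp add: field_simps)
  qed (use c \<theta> in auto)
  then show ?thesis
    by (rule lipschitz_on_continuous_on)
qed

text \<open>To pass from \<open>V (x, y)\<close> to \<open>V (x', y')\<close>, move first in the base (cost \<open>L\<close>) and then in the fibre
  (cost \<open>s\<close>). After weighting by \<open>\<theta>\<close>, the first cost joins the base term \<open>a\<close> as \<open>\<theta> * L\<close>, while the
  second one is \<open>s\<close> times the weighted fibre distance.\<close>

lemma skew_product_contraction: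
  assumes U: "\<And>x x'. x \<in> A \<Longrightarrow> x' \<in> A \<Longrightarrow> dist (U x) (U x') \<le> a * dist x x'"
    and V1: "\<And>x x' y. x \<in> A \<Longrightarrow> x' \<in> A \<Longrightarrow> dist (V (x, y)) (V (x', y)) \<le> L * dist x x'"
    and V2: "\<And>x y y'. x \<in> A \<Longrightarrow> dist (V (x, y)) (V (x, y')) \<le> s * dist y y'"
    and W: "\<And>x y. x \<in> A \<Longrightarrow> W (x, y) = (U x, V (x, y))"
    and p: "p \<in> A \<times> UNIV" and q: "q \<in> A \<times> UNIV"
  shows "d (W p) (W q) \<le> max (a + \<theta> * L) s * d p q"
proof -
  obtain x y x' y' where pq: "p = (x, y)" "q = (x', y')" "x \<in> A" "x' \<in> A"
    using p q by auto
  have "dist (V (x, y)) (V (x', y')) \<le> dist (V (x, y)) (V (x', y)) + dist (V (x', y)) (V (x', y'))"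
    by (rule dist_triangle)
  also have "\<dots> \<le> L * dist x x' + s * dist y y'"
    using pq by (intro add_mono V1 V2)
  finally have "\<theta> * dist (V (x, y)) (V (x', y')) \<le> \<theta> * (L * dist x x' + s * dist y y')"
    using \<theta> by (intro mult_left_mono) auto
  then have "d (W p) (W q) \<le> (a + \<theta> * L) * dist x x' + s * (\<theta> * dist y y')"
    using U[of x x'] pq by (simp add: W d algebra_simps)
  also have "\<dots> \<le> max (a + \<theta> * L) s * dist x x' + max (a + \<theta> * L) s * (\<theta> * dist y y')"
    using \<theta> by (intro add_mono mult_right_mono) auto
  finally show ?thesis
    using pq by (simp add: d distrib_left)
qed

end

section \<open>The fractal operator\<close>

text \<open>The combinatorial half of the setting: every point of \<open>X\<close> is \<open>u i x\<close> for exactly one index \<open>i\<close>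
  and exactly one \<open>x \<in> Xs i\<close>.\<close>

locale fractal_partition =
  fixes N :: nat and X :: "'a set" and Xs :: "nat \<Rightarrow> 'a set" and u :: "nat \<Rightarrow> 'a \<Rightarrow> 'a"
  assumes pieces: "\<And>i. i \<in> {1..N} \<Longrightarrow> Xs i \<subseteq> X"
    and inj: "\<And>i. i \<in> {1..N} \<Longrightarrow> inj_on (u i) (Xs i)"
    and disjoint: "disjoint_family_on (\<lambda>i. u i ` Xs i) {1..N}"
    and union: "(\<Union>i\<in>{1..N}. u i ` Xs i) = X"
begin

lemma image_mem: "i \<in> {1..N} \<Longrightarrow> x \<in> Xs i \<Longrightarrow> u i x \<in> X"
  using union by blast

text \<open>The self-referential equation that replaces the sums of characteristic functions from here on;
  disjointness of the images leaves one nonzero summand in each sum.\<close>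

lemma fractal_operator_eq:
  fixes lam :: "nat \<Rightarrow> 'a \<Rightarrow> 'b::real_vector"
  assumes i: "i \<in> {1..N}" and x: "x \<in> Xs i"
  shows "fractal_operator N X Xs u lam S f (u i x) = lam i x + S i x *\<^sub>R f x"
proof -
  have ind: "indicat_real (u j ` Xs j) (u i x) = (if j = i then 1 else 0)" if "j \<in> {1..N}" for j
    using disjoint_family_onD[OF disjoint that i] x by (auto simp: indicator_def)
  have sum: "(\<Sum>j=1..N. indicat_real (u j ` Xs j) (u i x) *\<^sub>R g j) = g i" for g :: "nat \<Rightarrow> 'b"
  proof -
    have "(\<Sum>j=1..N. indicat_real (u j ` Xs j) (u i x) *\<^sub>R g j) = (\<Sum>j=1..N. if j = i then g j else 0)"
      by (intro sum.cong refl) (use ind in auto)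
    then show ?thesis
      using i by simp
  qed
  have "inv_into (Xs i) (u i) (u i x) = x"
    using inj[OF i] x by simp
  then show ?thesis
    unfolding fractal_operator_def restrict_apply'[OF image_mem[OF i x]] sum using x by simp
qed

lemma fractal_operator_image:
  fixes lam :: "nat \<Rightarrow> 'a \<Rightarrow> 'b::real_vector"
  shows "fractal_operator N X Xs u lam S f ` X =
    (\<Union>i\<in>{1..N}. (\<lambda>x. lam i x + S i x *\<^sub>R f x) ` Xs i)"
proof -
  have "fractal_operator N X Xs u lam S f ` X =
      (\<Union>i\<in>{1..N}. fractal_operator N X Xs u lam S f ` (u i ` Xs i))"
    using union by blast
  also have "\<dots> = (\<Union>i\<in>{1..N}. (\<lambda>x. lam i x + S i x *\<^sub>R f x) ` Xs i)"
    by (intro SUP_cong refl) (simp add: image_image fractal_operator_eq cong: image_cong)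
  finally show ?thesis .
qed

text \<open>Each side is the set of all \<open>w i (x, f x) = (u i x, \<Phi> f (u i x))\<close> with \<open>x \<in> Xs i\<close>: on the left
  because the images of the \<open>u i\<close> cover \<open>X\<close>, on the right because the part of the graph of \<open>f\<close> over
  \<open>Xs i\<close> is what \<open>w i\<close> acts on.\<close>

lemma graph_fractal_operator:
  fixes lam :: "nat \<Rightarrow> 'a \<Rightarrow> 'b::real_vector"
  assumes w: "\<And>i x y. i \<in> {1..N} \<Longrightarrow> x \<in> Xs i \<Longrightarrow> w i (x, y) = (u i x, lam i x + S i x *\<^sub>R y)"
  shows "graph_on X (fractal_operator N X Xs u lam S f) =
    local_IFS_operator N (\<lambda>i. Xs i \<times> UNIV) w (graph_on X f)"
proof -
  let ?F = "fractal_operator N X Xs u lam S f"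
  have "graph_on X ?F = (\<Union>i\<in>{1..N}. (\<lambda>x. (u i x, ?F (u i x))) ` Xs i)"
    using union by (auto simp: graph_on_def)
  also have "\<dots> = (\<Union>i\<in>{1..N}. (\<lambda>x. w i (x, f x)) ` Xs i)"
    by (intro SUP_cong refl image_cong) (simp_all add: fractal_operator_eq w)
  also have "\<dots> = (\<Union>i\<in>{1..N}. w i ` (graph_on X f \<inter> Xs i \<times> UNIV))"
  proof (intro SUP_cong refl)
    fix i assume "i \<in> {1..N}"
    then have "graph_on X f \<inter> Xs i \<times> UNIV = (\<lambda>x. (x, f x)) ` Xs i"
      using pieces[of i] by (auto simp: graph_on_def)
    then show "(\<lambda>x. w i (x, f x)) ` Xs i = w i ` (graph_on X f \<inter> Xs i \<times> UNIV)"
      by (simp add: image_image)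
  qed
  finally show ?thesis
    by (simp add: local_IFS_operator_def)
qed

context
  fixes lam :: "nat \<Rightarrow> 'a \<Rightarrow> 'b::F_space" and S :: "nat \<Rightarrow> 'a \<Rightarrow> real" and c :: real
  assumes hom: "homogeneous_metric (dist :: 'b \<Rightarrow> 'b \<Rightarrow> real)"
    and lam: "\<And>i. i \<in> {1..N} \<Longrightarrow> bounded (lam i ` Xs i)"
    and S: "\<And>i x. i \<in> {1..N} \<Longrightarrow> x \<in> Xs i \<Longrightarrow> \<bar>S i x\<bar> \<le> c"
begin

lemma fractal_operator_bounded_maps:
  assumes f: "f \<in> bounded_maps X"
  shows "fractal_operator N X Xs u lam S f \<in> bounded_maps X"
proof -
  have "bounded ((\<lambda>x. lam i x + S i x *\<^sub>R f x) ` Xs i)" if i: "i \<in> {1..N}" for i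
  proof (rule bounded_affine_image_F_space[OF hom lam[OF i] _ S[OF i]])
    show "bounded (f ` Xs i)"
      using f pieces[OF i] by (auto simp: bounded_maps_iff_bounded_image intro: bounded_subset image_mono)
  qed auto
  then have "bounded (fractal_operator N X Xs u lam S f ` X)"
    unfolding fractal_operator_image by (intro bounded_UN) auto
  then show ?thesis
    by (simp add: bounded_maps_iff_bounded_image fractal_operator_def)
qed

text \<open>The pointwise form of the contraction estimate: \<open>\<Phi> f\<close> and \<open>\<Phi> g\<close> at \<open>u i x\<close> have the same summand
  \<open>lam i x\<close>, and their remaining parts differ by the factor \<open>S i x\<close> from \<open>f x\<close> and \<open>g x\<close>.\<close>

lemma dist_fractal_operator_le:
  assumes B: "\<And>x. x \<in> X \<Longrightarrow> dist (f x) (g x) \<le> B" and z: "z \<in> X"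
  shows "dist (fractal_operator N X Xs u lam S f z) (fractal_operator N X Xs u lam S g z) \<le> c * B"
proof -
  obtain i x where i: "i \<in> {1..N}" and x: "x \<in> Xs i" and z: "z = u i x"
    using z union by blast
  have "dist (fractal_operator N X Xs u lam S f z) (fractal_operator N X Xs u lam S g z) =
      dist (S i x *\<^sub>R f x) (S i x *\<^sub>R g x)"
    by (simp add: z fractal_operator_eq[OF i x] dist_add_left_F_space)
  also have "\<dots> = \<bar>S i x\<bar> * dist (f x) (g x)"
    using hom unfolding homogeneous_metric_def by blast
  also have "\<dots> \<le> c * B"
    using S[OF i x] B[of x] pieces[OF i] x by (intro mult_mono) auto
  finally show ?thesis .
qed

lemma fractal_operator_unique_fixed_point:
  assumes "X \<noteq> {}" and "c < 1"
  shows "\<exists>!f. f \<in> bounded_maps X \<and> fractal_operator N X Xs u lam S f = f"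
proof -
  let ?F = "fractal_operator N X Xs u lam S"
  let ?D = "mdist (funspace X (euclidean_metric :: 'b metric))"
  interpret B: Metric_space "bounded_maps X" ?D
    unfolding bounded_maps_def by (rule Metric_space_mspace_mdist)
  have le: "?D f g \<le> r \<longleftrightarrow> (\<forall>x\<in>X. dist (f x) (g x) \<le> r)"
    if "f \<in> bounded_maps X" "g \<in> bounded_maps X" for f g :: "'a \<Rightarrow> 'b" and r
    using funspace_mdist_le[of f X "euclidean_metric :: 'b metric" g r] that \<open>X \<noteq> {}\<close>
    unfolding bounded_maps_def mdist_euclidean_metric by blast
  have maps: "?F \<in> bounded_maps X \<rightarrow> bounded_maps X"
    using fractal_operator_bounded_maps by blast
  have con: "?D (?F f) (?F g) \<le> c * ?D f g"
    if fg: "f \<in> bounded_maps X" "g \<in> bounded_maps X" for f g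
    using dist_fractal_operator_le[of f g "?D f g"] le[OF fg, of "?D f g"]
      le[of "?F f" "?F g"] fractal_operator_bounded_maps fg by blast
  have "(\<lambda>x\<in>X. 0) \<in> bounded_maps X"
    by (auto simp: bounded_maps_iff_bounded_image image_constant_conv)
  then have "bounded_maps X \<noteq> ({} :: ('a \<Rightarrow> 'b) set)"
    by blast
  then obtain f where f: "f \<in> bounded_maps X" "?F f = f"
    using B.Banach_fixedpoint_thm[OF mcomplete_bounded_maps _ maps \<open>c < 1\<close> con] by blast
  moreover have "g = f" if g: "g \<in> bounded_maps X" "?F g = g" for g
    using B.contraction_imp_unique_fixpoint[OF g(2) f(2) maps \<open>c < 1\<close> con g(1) f(1)] .
  ultimately show ?thesis
    by blast
qed

end

end

section \<open>Local fractal functions as attractors\<close>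

theorem theorem6:
  fixes N :: nat
    and X :: "'a::complete_space set"
    and Xs :: "nat \<Rightarrow> 'a set"
    and u :: "nat \<Rightarrow> 'a \<Rightarrow> 'a"
    and lam :: "nat \<Rightarrow> 'a \<Rightarrow> 'b::F_space"
    and S :: "nat \<Rightarrow> 'a \<Rightarrow> real"
    and v :: "nat \<Rightarrow> 'a \<times> 'b \<Rightarrow> 'b"
    and w :: "nat \<Rightarrow> 'a \<times> 'b \<Rightarrow> 'a \<times> 'b"
    and a L \<theta> :: real
    and d\<^sub>\<theta> :: "'a \<times> 'b \<Rightarrow> 'a \<times> 'b \<Rightarrow> real"
    and \<Phi> :: "('a \<Rightarrow> 'b) \<Rightarrow> 'a \<Rightarrow> 'b"
    and \<ff> :: "'a \<Rightarrow> 'b"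
  assumes X: "X \<noteq> {}" "connected X" "closed X"
    and Xs: "\<And>i. i \<in> {1..N} \<Longrightarrow> Xs i \<noteq> {} \<and> connected (Xs i) \<and> Xs i \<subseteq> X"
    and homogeneous: "homogeneous_metric (dist :: 'b \<Rightarrow> 'b \<Rightarrow> real)"
    and u_maps: "\<And>i. i \<in> {1..N} \<Longrightarrow> u i ` Xs i \<subseteq> X"
    and u_lipschitz: "\<And>i. i \<in> {1..N} \<Longrightarrow> \<exists>C. C-lipschitz_on (Xs i) (u i)"
    and u_bij: "\<And>i. i \<in> {1..N} \<Longrightarrow> bij_betw (u i) (Xs i) (u i ` Xs i)"
    and u_disjoint: "disjoint_family_on (\<lambda>i. u i ` Xs i) {1..N}"
    and u_union: "(\<Union>i\<in>{1..N}. u i ` Xs i) = X"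
    and a_def: "a = Max ((\<lambda>i. lipschitz_constant (Xs i) (u i)) ` {1..N})"
    and a_less_1: "a < 1"
    and lam_bounded: "\<And>i. i \<in> {1..N} \<Longrightarrow> lam i \<in> bounded_maps (Xs i)"
    and S_bounded: "\<And>i. i \<in> {1..N} \<Longrightarrow> S i \<in> bounded_maps (Xs i)"
    and S_norm: "Max ((\<lambda>i. sup_norm_on (Xs i) (S i)) ` {1..N}) < 1"
    and v_def: "\<And>i x y. i \<in> {1..N} \<Longrightarrow> x \<in> Xs i \<Longrightarrow> v i (x, y) = lam i x + S i x *\<^sub>R y"
    and L_pos: "L > 0"
    and v_lipschitz: "\<And>i x\<^sub>1 x\<^sub>2 y. i \<in> {1..N} \<Longrightarrow> x\<^sub>1 \<in> Xs i \<Longrightarrow> x\<^sub>2 \<in> Xs i \<Longrightarrow>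
      dist (v i (x\<^sub>1, y)) (v i (x\<^sub>2, y)) \<le> L * dist x\<^sub>1 x\<^sub>2"
    and \<Phi>_def: "\<Phi> = fractal_operator N X Xs u lam S"
    and \<ff>_def: "\<ff> = (THE f. f \<in> bounded_maps X \<and> \<Phi> f = f)"
    and w_def: "\<And>i x y. i \<in> {1..N} \<Longrightarrow> x \<in> Xs i \<Longrightarrow> w i (x, y) = (u i x, v i (x, y))"
    and \<theta>_def: "\<theta> = (1 - a) / (2 * L)"
    and d\<^sub>\<theta>_def: "\<And>x\<^sub>1 y\<^sub>1 x\<^sub>2 y\<^sub>2. d\<^sub>\<theta> (x\<^sub>1, y\<^sub>1) (x\<^sub>2, y\<^sub>2) = dist x\<^sub>1 x\<^sub>2 + \<theta> * dist y\<^sub>1 y\<^sub>2"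
  shows "contractive_local_IFS_in d\<^sub>\<theta> (X \<times> UNIV) N (\<lambda>i. Xs i \<times> UNIV) w \<and>
      local_attractor (X \<times> UNIV) N (\<lambda>i. Xs i \<times> UNIV) w (graph_on X \<ff>) \<and>
      graph_on X (\<Phi> \<ff>) = local_IFS_operator N (\<lambda>i. Xs i \<times> UNIV) w (graph_on X \<ff>)"
proof -
  let ?s = "Max ((\<lambda>i. sup_norm_on (Xs i) (S i)) ` {1..N})"
  interpret fractal_partition N X Xs u
    using Xs u_bij u_disjoint u_union by unfold_locales (auto simp: bij_betw_def)
  have "\<theta> > 0"
    using a_less_1 L_pos by (simp add: \<theta>_def)
  have s: "\<bar>S i x\<bar> \<le> ?s" if i: "i \<in> {1..N}" and x: "x \<in> Xs i" for i x
  proof -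
    have "\<bar>S i x\<bar> \<le> sup_norm_on (Xs i) (S i)"
      using S_bounded[OF i] x by (rule abs_le_sup_norm_on)
    also have "\<dots> \<le> ?s"
      using i by (intro Max_ge) auto
    finally show ?thesis .
  qed
  have u: "dist (u i x) (u i x') \<le> a * dist x x'"
    if i: "i \<in> {1..N}" and x: "x \<in> Xs i" "x' \<in> Xs i" for i x x'
  proof -
    have "lipschitz_constant (Xs i) (u i) \<le> a"
      unfolding a_def using i by (intro Max_ge) auto
    then have "a-lipschitz_on (Xs i) (u i)"
      using lipschitz_on_lipschitz_constant[OF u_lipschitz[OF i]] by (rule lipschitz_on_le[rotated])
    then show ?thesis
      using x by (rule lipschitz_onD)
  qed
  have v: "dist (v i (x, y)) (v i (x, y')) \<le> ?s * dist y y'"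
    if i: "i \<in> {1..N}" and x: "x \<in> Xs i" for i x y y'
  proof -
    have "dist (v i (x, y)) (v i (x, y')) = \<bar>S i x\<bar> * dist y y'"
      using homogeneous v_def[OF i x] by (simp add: dist_add_left_F_space homogeneous_metric_def)
    then show ?thesis
      using s[OF i x] by (simp add: mult_right_mono)
  qed

  let ?c = "max (a + \<theta> * L) ?s"
  have con: "d\<^sub>\<theta> (w i p) (w i q) \<le> ?c * d\<^sub>\<theta> p q"
    if "i \<in> {1..N}" "p \<in> Xs i \<times> UNIV" "q \<in> Xs i \<times> UNIV" for i p q
    using that by (intro skew_product_contraction[OF d\<^sub>\<theta>_def \<open>\<theta> > 0\<close>, where U = "u i" and V = "v i" and A = "Xs i"]
        u v v_lipschitz w_def) auto
  \<comment> \<open>The choice of \<open>\<theta>\<close> splits the gap between \<open>a\<close> and \<open>1\<close> evenly.\<close>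
  have "a + \<theta> * L = (1 + a) / 2"
    using L_pos by (simp add: \<theta>_def field_simps)
  then have c_less: "?c < 1"
    using a_less_1 S_norm by simp
  \<comment> \<open>\<open>X\<close> is nonempty, so some \<open>S i\<close> has a value, and its modulus bounds \<open>?c\<close> from below.\<close>
  obtain i\<^sub>0 x\<^sub>0 where "i\<^sub>0 \<in> {1..N}" "x\<^sub>0 \<in> Xs i\<^sub>0"
    using X(1) u_union by blast
  then have c_nonneg: "0 \<le> ?c"
    using s[of i\<^sub>0 x\<^sub>0] by linarith

  have "local_IFS (X \<times> UNIV) N (\<lambda>i. Xs i \<times> UNIV) w"
    unfolding local_IFS_def
  proof (intro ballI conjI)
    fix i assume i: "i \<in> {1..N}"
    show "Xs i \<times> UNIV \<noteq> {}" "Xs i \<times> UNIV \<subseteq> X \<times> UNIV"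
      using Xs[OF i] by auto
    show "w i ` (Xs i \<times> UNIV) \<subseteq> X \<times> UNIV"
      using image_mem[OF i] w_def[OF i] by auto
    show "continuous_on (Xs i \<times> UNIV) (w i)"
      using c_nonneg con[OF i]
      by (rule contraction_imp_continuous_on_weighted_sum_metric[OF d\<^sub>\<theta>_def \<open>\<theta> > 0\<close>])
  qed
  then have IFS: "contractive_local_IFS_in d\<^sub>\<theta> (X \<times> UNIV) N (\<lambda>i. Xs i \<times> UNIV) w"
    unfolding contractive_local_IFS_in_def
    using Metric_space_weighted_sum_metric[OF d\<^sub>\<theta>_def \<open>\<theta> > 0\<close>]
      mtopology_weighted_sum_metric[OF d\<^sub>\<theta>_def \<open>\<theta> > 0\<close>] c_nonneg c_less con by blast

  have graph: "graph_on X (\<Phi> \<ff>) = local_IFS_operator N (\<lambda>i. Xs i \<times> UNIV) w (graph_on X \<ff>)"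
    unfolding \<Phi>_def by (rule graph_fractal_operator) (simp add: w_def v_def)

  have "\<exists>!f. f \<in> bounded_maps X \<and> \<Phi> f = f"
    unfolding \<Phi>_def
  proof (rule fractal_operator_unique_fixed_point[OF homogeneous _ s X(1) S_norm])
    show "bounded (lam i ` Xs i)" if "i \<in> {1..N}" for i
      using lam_bounded[OF that] by (simp add: bounded_maps_iff_bounded_image)
  qed
  then have "\<Phi> \<ff> = \<ff>"
    unfolding \<ff>_def by (rule theI'[THEN conjunct2])
  then have "local_attractor (X \<times> UNIV) N (\<lambda>i. Xs i \<times> UNIV) w (graph_on X \<ff>)"
    using graph by (auto simp: local_attractor_def graph_on_def)
  then show ?thesis
    using IFS graph by blast
qed

end
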